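(* Let $\Omega\subseteq\mathbf{H}$ be a domain and let $f:\Omega\to\mathbf{H}$ be a function of class $C^1$. The following statements are equivalent: 1. $f$ is left-Cullen-regular in $\Omega$. 2. $f$ satisfies $$D_l(\iota f)+\iota\, D_l f=\frac{-2f}{r}\quad\text{in }\Omega\setminus\mathbf{R}.$$ 3. There exist quaternion-valued functions $u$ and $v$ on $\Omega\setminus\mathbf{R}$ such that $f=u+\iota v$ and $$D_l f=\frac{-2v}{r},\qquad D_l(\iota f)=\frac{-2u}{r}\quad\text{in }\Omega\setminus\mathbf{R}.$$ 4. There exist quaternion-valued functions $u$ and $v$ on $\Omega\setminus\mathbf{R}$ such that $f=u+\iota v$ and $$D_l\Big(\frac{f}{r^2}\Big)=\frac{-2\iota u}{r^3},\qquad D_l\Big(\frac{\iota f}{r^2}\Big)=\frac{2\iota v}{r^3}\quad\text{in }\Omega\setminus\mathbf{R}.$$ The functions $u$ and $v$ in 3 and in 4 are the same, i.e. a pair $(u,v)$ is as in 3 if and only if it is as in 4.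
   Context: $\mathbf{H}$ is the algebra of quaternions with standard basis $1,i,j,k$, and $\mathbf{R}\subset\mathbf{H}$ denotes the real quaternions. A domain is a connected open subset of $\mathbf{H}\cong\mathbb{R}^4$. Write $p=t+xi+yj+zk$ with $t,x,y,z$ real. For $p\notin\mathbf{R}$ put $r:=\sqrt{x^2+y^2+z^2}>0$ and $\iota:=\dfrac{xi+yj+zk}{r}$, so that $p=t+r\iota$ and $\iota^2=-1$; $r$ and $\iota$ are regarded as functions of $p\in\mathbf{H}\setminus\mathbf{R}$. Products such as $\iota f$ are pointwise quaternion products in the indicated order. The left-Fueter operator is $$D_l:=\frac{\partial}{\partial t}+i\frac{\partial}{\partial x}+j\frac{\partial}{\partial y}+k\frac{\partial}{\partial z},$$ with the units multiplying the partial derivatives on the left. The left-Cullen operator is $\dfrac{\partial}{\partial t}+\iota\dfrac{\partial}{\partial r}$, where $\partial/\partial r$ is differentiation with respect to $r$ in $p=t+r\iota$ with $t$ and the imaginary unit $\iota$ held fixed, i.e. $\dfrac{\partial}{\partial r}=\dfrac{1}{r}\left(x\dfrac{\partial}{\partial x}+y\dfrac{\partial}{\partial y}+z\dfrac{\partial}{\partial z}\right)$. A function $f:\Omega\to\mathbf{H}$ of class $C^1$ is left-Cullen-regular in $\Omega$ if $\dfrac{\partial f}{\partial t}+\iota\dfrac{\partial f}{\partial r}=0$ (an equation at the points of $\Omega\setminus\mathbf{R}$, where $\iota$ is defined). *)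

theory Defs
  imports "HOL-Analysis.Analysis"
begin

section \<open>Quaternions\<close>

datatype quat = Quat (Ret: real) (Imx: real) (Imy: real) (Imz: real)

lemma quat_eq_iff:
  "p = q \<longleftrightarrow> Ret p = Ret q \<and> Imx p = Imx q \<and> Imy p = Imy q \<and> Imz p = Imz q"
  by (cases p; cases q) simp

instantiation quat :: ab_group_add
begin

definition "0 = Quat 0 0 0 0"

definition "p + q = Quat (Ret p + Ret q) (Imx p + Imx q) (Imy p + Imy q) (Imz p + Imz q)"

definition "- p = Quat (- Ret p) (- Imx p) (- Imy p) (- Imz p)" for p :: quat

definition "p - q = Quat (Ret p - Ret q) (Imx p - Imx q) (Imy p - Imy q) (Imz p - Imz q)"

instance
  by standard (simp_all add: zero_quat_def plus_quat_def uminus_quat_def minus_quat_def)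

end

lemma quat_group_sel [simp]:
  "Ret 0 = 0" "Imx 0 = 0" "Imy 0 = 0" "Imz 0 = 0"
  "Ret (p + q) = Ret p + Ret q" "Imx (p + q) = Imx p + Imx q"
  "Imy (p + q) = Imy p + Imy q" "Imz (p + q) = Imz p + Imz q"
  "Ret (- p) = - Ret p" "Imx (- p) = - Imx p" "Imy (- p) = - Imy p" "Imz (- p) = - Imz p"
  "Ret (p - q) = Ret p - Ret q" "Imx (p - q) = Imx p - Imx q"
  "Imy (p - q) = Imy p - Imy q" "Imz (p - q) = Imz p - Imz q"
  by (simp_all add: zero_quat_def plus_quat_def uminus_quat_def minus_quat_def)

instantiation quat :: real_vector
begin

definition "scaleR a p = Quat (a * Ret p) (a * Imx p) (a * Imy p) (a * Imz p)"

instance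
  by standard (simp_all add: scaleR_quat_def quat_eq_iff algebra_simps)

end

lemma quat_scaleR_sel [simp]:
  "Ret (a *\<^sub>R p) = a * Ret p" "Imx (a *\<^sub>R p) = a * Imx p"
  "Imy (a *\<^sub>R p) = a * Imy p" "Imz (a *\<^sub>R p) = a * Imz p"
  by (simp_all add: scaleR_quat_def)

instantiation quat :: real_algebra_1
begin

definition "1 = Quat 1 0 0 0"

definition
  "p * q = Quat
    (Ret p * Ret q - Imx p * Imx q - Imy p * Imy q - Imz p * Imz q)
    (Ret p * Imx q + Imx p * Ret q + Imy p * Imz q - Imz p * Imy q)
    (Ret p * Imy q - Imx p * Imz q + Imy p * Ret q + Imz p * Imx q)
    (Ret p * Imz q + Imx p * Imy q - Imy p * Imx q + Imz p * Ret q)"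

instance
  by standard (simp_all add: one_quat_def times_quat_def quat_eq_iff algebra_simps)

end

lemma quat_times_sel [simp]:
  "Ret 1 = 1" "Imx 1 = 0" "Imy 1 = 0" "Imz 1 = 0"
  "Ret (p * q) = Ret p * Ret q - Imx p * Imx q - Imy p * Imy q - Imz p * Imz q"
  "Imx (p * q) = Ret p * Imx q + Imx p * Ret q + Imy p * Imz q - Imz p * Imy q"
  "Imy (p * q) = Ret p * Imy q - Imx p * Imz q + Imy p * Ret q + Imz p * Imx q"
  "Imz (p * q) = Ret p * Imz q + Imx p * Imy q - Imy p * Imx q + Imz p * Ret q"
  by (simp_all add: one_quat_def times_quat_def)

definition qi :: quat where "qi = Quat 0 1 0 0"
definition qj :: quat where "qj = Quat 0 0 1 0"
definition qk :: quat where "qk = Quat 0 0 0 1"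

lemma quat_unit_sel [simp]:
  "Ret qi = 0" "Imx qi = 1" "Imy qi = 0" "Imz qi = 0"
  "Ret qj = 0" "Imx qj = 0" "Imy qj = 1" "Imz qj = 0"
  "Ret qk = 0" "Imx qk = 0" "Imy qk = 0" "Imz qk = 1"
  by (simp_all add: qi_def qj_def qk_def)

lemma quat_unit_products:
  "qi * qi = - 1" "qj * qj = - 1" "qk * qk = - 1"
  "qi * qj = qk" "qj * qk = qi" "qk * qi = qj"
  "qj * qi = - qk" "qk * qj = - qi" "qi * qk = - qj"
  by (simp_all add: quat_eq_iff)

lemma quat_expansion:
  "p = of_real (Ret p) + Imx p *\<^sub>R qi + Imy p *\<^sub>R qj + Imz p *\<^sub>R qk"
  by (simp add: quat_eq_iff of_real_def)

lemma quat_Reals_iff: "p \<in> \<real> \<longleftrightarrow> Imx p = 0 \<and> Imy p = 0 \<and> Imz p = 0"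
  by (auto simp: Reals_def of_real_def quat_eq_iff image_iff intro!: exI[of _ "Ret p"])

instantiation quat :: real_inner
begin

definition "inner p q = Ret p * Ret q + Imx p * Imx q + Imy p * Imy q + Imz p * Imz q"

definition "norm p = sqrt ((Ret p)\<^sup>2 + (Imx p)\<^sup>2 + (Imy p)\<^sup>2 + (Imz p)\<^sup>2)"

definition "sgn p = p /\<^sub>R norm p" for p :: quat

definition "dist p q = norm (p - q)" for p q :: quat

definition [code del]:
  "(uniformity :: (quat \<times> quat) filter) = (INF e\<in>{0 <..}. principal {(p, q). dist p q < e})"

definition [code del]:
  "open (U :: quat set) \<longleftrightarrow> (\<forall>p\<in>U. eventually (\<lambda>(p', q). p' = p \<longrightarrow> q \<in> U) uniformity)"

instance
proof
  fix p q s :: quat and a :: real and U :: "quat set"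
  show "dist p q = norm (p - q)" by (rule dist_quat_def)
  show "sgn p = p /\<^sub>R norm p" by (rule sgn_quat_def)
  show "(uniformity :: (quat \<times> quat) filter) = (INF e\<in>{0 <..}. principal {(p, q). dist p q < e})"
    by (rule uniformity_quat_def)
  show "open U \<longleftrightarrow> (\<forall>p\<in>U. eventually (\<lambda>(p', q). p' = p \<longrightarrow> q \<in> U) uniformity)"
    by (rule open_quat_def)
  show "inner p q = inner q p"
    and "inner (p + q) s = inner p s + inner q s"
    and "inner (a *\<^sub>R p) q = a * inner p q"
    by (simp_all add: inner_quat_def algebra_simps)
  show "0 \<le> inner p p"
    by (simp add: inner_quat_def)
  show "inner p p = 0 \<longleftrightarrow> p = 0"
    by (auto simp: inner_quat_def quat_eq_iff add_nonneg_eq_0_iff)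
  show "norm p = sqrt (inner p p)"
    by (simp add: norm_quat_def inner_quat_def power2_eq_square)
qed

end

instantiation quat :: euclidean_space
begin

definition "Basis = {1, qi, qj, qk}"

instance
proof
  show "(Basis :: quat set) \<noteq> {}" "finite (Basis :: quat set)"
    by (simp_all add: Basis_quat_def)
  fix p q :: quat
  show "p \<in> Basis \<Longrightarrow> q \<in> Basis \<Longrightarrow> inner p q = (if p = q then 1 else 0)"
    by (auto simp: Basis_quat_def inner_quat_def quat_eq_iff)
  show "(\<forall>q\<in>Basis. inner p q = 0) \<longleftrightarrow> p = 0"
    by (simp add: Basis_quat_def inner_quat_def) (simp add: quat_eq_iff)
qed

end

instance quat :: real_normed_algebra_1
proof
  fix p q :: quat
  have "(norm (p * q))\<^sup>2 = (norm p * norm q)\<^sup>2"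
    by (simp add: power_mult_distrib norm_quat_def) (simp add: power2_eq_square algebra_simps)
  then show "norm (p * q) \<le> norm p * norm q"
    by (simp add: power2_eq_iff_nonneg)
  show "norm (1 :: quat) = 1"
    by (simp add: norm_quat_def)
qed

section \<open>Cullen and Fueter operators\<close>

definition rad :: "quat \<Rightarrow> real" where
  "rad p = sqrt ((Imx p)\<^sup>2 + (Imy p)\<^sup>2 + (Imz p)\<^sup>2)"

text \<open>Only meaningful off \<open>\<real>\<close>; at real points \<open>\<iota>\<close> is \<open>0\<close>.\<close>

definition \<iota> :: "quat \<Rightarrow> quat" where
  "\<iota> p = (Imx p *\<^sub>R qi + Imy p *\<^sub>R qj + Imz p *\<^sub>R qk) /\<^sub>R rad p"

lemma rad_pos: "p \<notin> \<real> \<Longrightarrow> rad p > 0"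
  using sum_power2_ge_zero[of "Imx p" "Imy p"]
  by (auto simp: rad_def quat_Reals_iff add_nonneg_pos add_pos_nonneg sum_power2_gt_zero_iff)

lemma quat_polar:
  assumes "p \<notin> \<real>"
  shows "p = of_real (Ret p) + rad p *\<^sub>R \<iota> p"
  using rad_pos[OF assms] by (simp add: \<iota>_def quat_eq_iff of_real_def)

lemma iota_square:
  assumes "p \<notin> \<real>"
  shows "\<iota> p * \<iota> p = - 1"
proof -
  have "(rad p)\<^sup>2 = (Imx p)\<^sup>2 + (Imy p)\<^sup>2 + (Imz p)\<^sup>2"
    by (simp add: rad_def)
  then have "(Imx p / rad p)\<^sup>2 + (Imy p / rad p)\<^sup>2 + (Imz p / rad p)\<^sup>2 = 1"
    using rad_pos[OF assms] zero_less_power[of "rad p" 2]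
    by (simp add: power_divide flip: add_divide_distrib)
  then show ?thesis
    by (simp add: \<iota>_def quat_eq_iff divide_inverse power2_eq_square algebra_simps)
qed

definition partial_deriv :: "quat \<Rightarrow> (quat \<Rightarrow> quat) \<Rightarrow> quat \<Rightarrow> quat" where
  "partial_deriv e f p = vector_derivative (\<lambda>s. f (p + s *\<^sub>R e)) (at 0)"

definition left_Fueter :: "(quat \<Rightarrow> quat) \<Rightarrow> quat \<Rightarrow> quat" where
  "left_Fueter f p =
    partial_deriv 1 f p + qi * partial_deriv qi f p + qj * partial_deriv qj f p
      + qk * partial_deriv qk f p"

definition radial_deriv :: "(quat \<Rightarrow> quat) \<Rightarrow> quat \<Rightarrow> quat" where
  "radial_deriv f p = vector_derivative (\<lambda>s. f (of_real (Ret p) + s *\<^sub>R \<iota> p)) (at (rad p))"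

definition left_Cullen :: "(quat \<Rightarrow> quat) \<Rightarrow> quat \<Rightarrow> quat" where
  "left_Cullen f p = partial_deriv 1 f p + \<iota> p * radial_deriv f p"

lemma partial_deriv_eq:
  assumes "(f has_derivative f') (at p)"
  shows "partial_deriv e f p = f' e"
proof -
  have "((\<lambda>s::real. p + s *\<^sub>R e) has_derivative (\<lambda>s. s *\<^sub>R e)) (at 0)"
    by (auto intro!: derivative_eq_intros)
  then have "((\<lambda>s. f (p + s *\<^sub>R e)) has_derivative (\<lambda>s. f' (s *\<^sub>R e))) (at 0)"
    by (rule has_derivative_compose) (use assms in simp)
  then have "((\<lambda>s. f (p + s *\<^sub>R e)) has_vector_derivative f' e) (at 0)"
    using linear_scale[OF has_derivative_linear[OF assms]]
    by (simp add: has_vector_derivative_def)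
  then show ?thesis
    unfolding partial_deriv_def by (rule vector_derivative_at)
qed

lemma radial_deriv_eq:
  assumes "p \<notin> \<real>" "f differentiable (at p)"
  shows "radial_deriv f p =
    (Imx p *\<^sub>R partial_deriv qi f p + Imy p *\<^sub>R partial_deriv qj f p
      + Imz p *\<^sub>R partial_deriv qk f p) /\<^sub>R rad p"
proof -
  obtain f' where f': "(f has_derivative f') (at p)"
    using assms(2) by (auto simp: differentiable_def)
  note lin = has_derivative_linear[OF f']
  have "((\<lambda>s::real. of_real (Ret p) + s *\<^sub>R \<iota> p) has_derivative (\<lambda>s. s *\<^sub>R \<iota> p)) (at (rad p))"
    by (auto intro!: derivative_eq_intros)
  then have "((\<lambda>s. f (of_real (Ret p) + s *\<^sub>R \<iota> p)) has_derivative (\<lambda>s. f' (s *\<^sub>R \<iota> p)))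
      (at (rad p))"
    by (rule has_derivative_compose) (use f' quat_polar[OF assms(1)] in simp)
  then have "((\<lambda>s. f (of_real (Ret p) + s *\<^sub>R \<iota> p)) has_vector_derivative f' (\<iota> p)) (at (rad p))"
    using linear_scale[OF lin] by (simp add: has_vector_derivative_def)
  then have "radial_deriv f p = f' (\<iota> p)"
    unfolding radial_deriv_def by (rule vector_derivative_at)
  then show ?thesis
    by (simp add: \<iota>_def partial_deriv_eq[OF f'] linear_scale[OF lin] linear_add[OF lin])
qed

definition C1_on :: "(quat \<Rightarrow> quat) \<Rightarrow> quat set \<Rightarrow> bool" where
  "C1_on f \<Omega> \<longleftrightarrow>
    (\<exists>f' :: quat \<Rightarrow> quat \<Rightarrow>\<^sub>L quat.
      (\<forall>p\<in>\<Omega>. (f has_derivative blinfun_apply (f' p)) (at p)) \<and> continuous_on \<Omega> f')"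

definition left_Cullen_regular :: "(quat \<Rightarrow> quat) \<Rightarrow> quat set \<Rightarrow> bool" where
  "left_Cullen_regular f \<Omega> \<longleftrightarrow> C1_on f \<Omega> \<and> (\<forall>p\<in>\<Omega> - \<real>. left_Cullen f p = 0)"

definition Fueter_pair :: "(quat \<Rightarrow> quat) \<Rightarrow> quat set \<Rightarrow> (quat \<Rightarrow> quat) \<Rightarrow> (quat \<Rightarrow> quat) \<Rightarrow> bool" where
  "Fueter_pair f \<Omega> u v \<longleftrightarrow>
    (\<forall>p\<in>\<Omega> - \<real>.
      f p = u p + \<iota> p * v p \<and>
      left_Fueter f p = (- 2 *\<^sub>R v p) /\<^sub>R rad p \<and>
      left_Fueter (\<lambda>q. \<iota> q * f q) p = (- 2 *\<^sub>R u p) /\<^sub>R rad p)"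

definition weighted_Fueter_pair ::
    "(quat \<Rightarrow> quat) \<Rightarrow> quat set \<Rightarrow> (quat \<Rightarrow> quat) \<Rightarrow> (quat \<Rightarrow> quat) \<Rightarrow> bool" where
  "weighted_Fueter_pair f \<Omega> u v \<longleftrightarrow>
    (\<forall>p\<in>\<Omega> - \<real>.
      f p = u p + \<iota> p * v p \<and>
      left_Fueter (\<lambda>q. f q /\<^sub>R (rad q)\<^sup>2) p = (- 2 *\<^sub>R (\<iota> p * u p)) /\<^sub>R (rad p) ^ 3 \<and>
      left_Fueter (\<lambda>q. (\<iota> q * f q) /\<^sub>R (rad q)\<^sup>2) p = (2 *\<^sub>R (\<iota> p * v p)) /\<^sub>R (rad p) ^ 3)"

end

theory Submission
  imports Defs
begin

text \<open>
  All four statements compare first derivatives of \<open>f\<close> at single points \<open>p \<notin> \<real>\<close>, and two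
  pointwise computations carry the theorem.

  The first is the pointwise identity, valid for every differentiable \<open>f\<close>,
  \[ D_l(\iota f) + \iota D_l f = -\frac{2f}{r} + 2 \iota
     \Bigl(\frac{\partial f}{\partial t} + \iota \frac{\partial f}{\partial r}\Bigr) \]
  (\<open>left_Fueter_iota_mult\<close>). It comes from the Leibniz rule: differentiating \<open>\<iota>\<close> contributes
  \<open>(D\<^sub>l \<iota>) f = - 2 f / r\<close>, and moving the units of \<open>D\<^sub>l\<close> past \<open>\<iota>\<close> costs a radial derivative, because
  imaginary quaternions anticommute up to an inner product. As \<open>\<iota>\<close> is a unit, the Cullen
  equation holds exactly when the last term vanishes, which is statement 2.

  A pair \<open>(u, v)\<close> as in statement 3 is determined by \<open>f\<close>: its equations say
  \<open>v = - r D\<^sub>l f / 2\<close> and \<open>u = - r D\<^sub>l(\<iota> f) / 2\<close>. The remaining condition \<open>f = u + \<iota> v\<close> on these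
  functions is then precisely statement 2.

  The second computation is \<open>D\<^sub>l (g / r\<^sup>2) = D\<^sub>l g / r\<^sup>2 - 2 \<iota> g / r\<^sup>3\<close>
  (\<open>left_Fueter_div_rad_power\<close>). With \<open>g = f\<close> and \<open>g = \<iota> f\<close>, and with \<open>f = u + \<iota> v\<close>, the
  correction terms turn the equations of statement 3 into those of statement 4 and back, for
  one and the same pair \<open>(u, v)\<close>.
\<close>

section \<open>Leibniz rules for the Fueter operator\<close>

lemma partial_deriv_mult:
  assumes "a differentiable (at p)" and "f differentiable (at p)"
  shows "partial_deriv e (\<lambda>q. a q * f q) p = partial_deriv e a p * f p + a p * partial_deriv e f p"
proof -
  obtain a' f' where a': "(a has_derivative a') (at p)" and f': "(f has_derivative f') (at p)"
    using assms by (auto simp: differentiable_def)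
  show ?thesis
    using partial_deriv_eq[OF has_derivative_mult[OF a' f']]
    by (simp add: partial_deriv_eq[OF a'] partial_deriv_eq[OF f'])
qed

text \<open>A real factor commutes with the units, so \<open>D\<^sub>l\<close> obeys the Leibniz rule for it, with the
  quaternionic gradient of the factor acting on the left.\<close>

lemma left_Fueter_scaleR:
  assumes g: "(g has_derivative g') (at p)" and "f differentiable (at p)"
  shows "left_Fueter (\<lambda>q. g q *\<^sub>R f q) p =
    g p *\<^sub>R left_Fueter f p + (g' 1 *\<^sub>R 1 + g' qi *\<^sub>R qi + g' qj *\<^sub>R qj + g' qk *\<^sub>R qk) * f p"
proof -
  obtain f' where f': "(f has_derivative f') (at p)"
    using assms(2) by (auto simp: differentiable_def)
  have "partial_deriv e (\<lambda>q. g q *\<^sub>R f q) p = g p *\<^sub>R partial_deriv e f p + g' e *\<^sub>R f p" for e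
    using partial_deriv_eq[OF has_derivative_scaleR[OF g f']] by (simp add: partial_deriv_eq[OF f'])
  then show ?thesis
    unfolding left_Fueter_def by (simp add: algebra_simps)
qed

section \<open>The radius and the imaginary unit as functions\<close>

lemma rad_square: "(rad p)\<^sup>2 = (Imx p)\<^sup>2 + (Imy p)\<^sup>2 + (Imz p)\<^sup>2"
  by (simp add: rad_def)

lemma bounded_linear_imaginary_coordinates:
  "bounded_linear Imx" "bounded_linear Imy" "bounded_linear Imz"
  using bounded_linear_inner_left[of qi] bounded_linear_inner_left[of qj]
    bounded_linear_inner_left[of qk]
  by (simp_all add: inner_quat_def)

lemmas has_derivative_imaginary_coordinates [derivative_intros] =
  bounded_linear_imaginary_coordinates[THEN bounded_linear.has_derivative]

lemma has_derivative_rad [derivative_intros]: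
  assumes "p \<notin> \<real>"
  shows "(rad has_derivative
    (\<lambda>h. (Imx p * Imx h + Imy p * Imy h + Imz p * Imz h) / rad p)) (at p)"
proof -
  have "(Imx p)\<^sup>2 + (Imy p)\<^sup>2 + (Imz p)\<^sup>2 > 0"
    using rad_pos[OF assms] by (simp flip: rad_square)
  then have "((\<lambda>q. sqrt ((Imx q)\<^sup>2 + (Imy q)\<^sup>2 + (Imz q)\<^sup>2)) has_derivative
    (\<lambda>h. (Imx p * Imx h + Imy p * Imy h + Imz p * Imz h) / rad p)) (at p)"
    by (auto intro!: derivative_eq_intros simp: rad_def field_simps)
  then show ?thesis
    by (simp add: rad_def[abs_def])
qed

lemma has_derivative_inverse_rad_power:
  assumes "p \<notin> \<real>"
  shows "((\<lambda>q. inverse (rad q ^ n)) has_derivative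
    (\<lambda>h. - (real n * (Imx p * Imx h + Imy p * Imy h + Imz p * Imz h) / rad p ^ (n + 2)))) (at p)"
proof -
  have r: "rad p > 0"
    by (rule rad_pos[OF assms])
  have "((\<lambda>s. inverse (s ^ n)) has_real_derivative
      - (real n * rad p ^ (n - Suc 0) * inverse ((rad p ^ n) ^ Suc (Suc 0)))) (at (rad p))"
    by (rule DERIV_inverse_fun[OF DERIV_pow]) (use r in simp)
  also have "- (real n * rad p ^ (n - Suc 0) * inverse ((rad p ^ n) ^ Suc (Suc 0))) =
      - (real n / rad p ^ (n + 1))"
    using r by (cases n) (simp_all add: field_simps)
  finally have "((\<lambda>q. inverse (rad q ^ n)) has_derivative
      (\<lambda>h. (Imx p * Imx h + Imy p * Imy h + Imz p * Imz h) / rad p * - (real n / rad p ^ (n + 1))))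
      (at p)"
    by (rule DERIV_compose_FDERIV) (rule has_derivative_rad[OF assms])
  then show ?thesis
    by (simp add: ac_simps)
qed

text \<open>The weight is radial, so its quaternionic gradient \<open>- n \<iota> / r\<^sup>n\<^sup>+\<^sup>1\<close> points along \<open>\<iota>\<close>.\<close>

lemma left_Fueter_div_rad_power:
  assumes "p \<notin> \<real>" and g: "g differentiable (at p)"
  shows "left_Fueter (\<lambda>q. g q /\<^sub>R rad q ^ n) p =
    left_Fueter g p /\<^sub>R rad p ^ n - (real n *\<^sub>R (\<iota> p * g p)) /\<^sub>R rad p ^ (n + 1)"
proof -
  let ?g' = "\<lambda>h. - (real n * (Imx p * Imx h + Imy p * Imy h + Imz p * Imz h) / rad p ^ (n + 2))"
  have "?g' 1 *\<^sub>R 1 + ?g' qi *\<^sub>R qi + ?g' qj *\<^sub>R qj + ?g' qk *\<^sub>R qk =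
      - (real n / rad p ^ (n + 1)) *\<^sub>R \<iota> p"
    using rad_pos[OF assms(1)] by (simp add: \<iota>_def quat_eq_iff field_simps)
  then show ?thesis
    unfolding left_Fueter_scaleR[OF has_derivative_inverse_rad_power[OF assms(1)] g]
    by (simp add: divide_inverse mult.commute)
qed

lemma iota_mult_iota_mult:
  assumes "p \<notin> \<real>"
  shows "\<iota> p * (\<iota> p * a) = - a"
  by (simp add: iota_square[OF assms] flip: mult.assoc)

text \<open>The imaginary part \<open>w\<close> of \<open>p\<close> satisfies \<open>D\<^sub>l w = - 3\<close>, one from each imaginary unit;
  the gradient \<open>- \<iota> / r\<^sup>2\<close> of \<open>1 / r\<close> multiplied by \<open>w = r \<iota>\<close> returns \<open>1 / r\<close>.\<close>

lemma
  assumes "p \<notin> \<real>"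
  shows iota_differentiable: "\<iota> differentiable (at p)"
    and left_Fueter_iota: "left_Fueter \<iota> p = - ((2 / rad p) *\<^sub>R 1)"
proof -
  let ?w = "\<lambda>q. Imx q *\<^sub>R qi + Imy q *\<^sub>R qj + Imz q *\<^sub>R qk"
  have r: "rad p > 0"
    by (rule rad_pos[OF assms])
  have w: "(?w has_derivative ?w) (at p)"
    by (auto intro!: derivative_eq_intros)
  have iota: "\<iota> = (\<lambda>q. ?w q /\<^sub>R rad q ^ 1)"
    by (simp add: \<iota>_def fun_eq_iff)
  show "\<iota> differentiable (at p)"
    unfolding iota
    by (rule differentiableI has_derivative_scaleR has_derivative_inverse_rad_power assms w)+
  have "left_Fueter \<iota> p = left_Fueter ?w p /\<^sub>R rad p - (\<iota> p * ?w p) /\<^sub>R (rad p)\<^sup>2"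
    using left_Fueter_div_rad_power[OF assms differentiableI[OF w], of 1, folded iota]
    by (simp add: power2_eq_square)
  also have "left_Fueter ?w p = - (3 *\<^sub>R 1)"
    unfolding left_Fueter_def by (simp add: partial_deriv_eq[OF w] quat_eq_iff)
  also have "?w p = rad p *\<^sub>R \<iota> p"
    using r by (simp add: \<iota>_def)
  finally show "left_Fueter \<iota> p = - ((2 / rad p) *\<^sub>R 1)"
    using r by (simp add: iota_square[OF assms] quat_eq_iff power2_eq_square field_simps)
qed

section \<open>Fueter and Cullen operators compared\<close>

lemma imaginary_mult_commute:
  fixes a b :: quat
  assumes "Ret a = 0" and "Ret b = 0"
  shows "a * b = - (b * a) - (2 * inner a b) *\<^sub>R 1"
  using assms by (simp add: quat_eq_iff inner_quat_def)

text \<open>The terms \<open>e \<iota> \<partial>\<^sub>e f\<close> of the Leibniz rule become \<open>- \<iota> e \<partial>\<^sub>e f\<close> for imaginary units \<open>e\<close>,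
  up to inner products \<open>\<langle>e, \<iota>\<rangle>\<close> which are the direction cosines of the radial derivative. The
  real unit commutes with \<open>\<iota>\<close> instead, so that adding \<open>\<iota> D\<^sub>l f\<close> doubles \<open>\<iota> \<partial>f/\<partial>t\<close> while it cancels
  the terms \<open>- \<iota> e \<partial>\<^sub>e f\<close>.\<close>

lemma left_Fueter_iota_mult:
  assumes "p \<notin> \<real>" and f: "f differentiable (at p)"
  shows "left_Fueter (\<lambda>q. \<iota> q * f q) p + \<iota> p * left_Fueter f p =
    (- 2 *\<^sub>R f p) /\<^sub>R rad p + 2 *\<^sub>R (\<iota> p * left_Cullen f p)"
proof -
  let ?d = "\<lambda>e. partial_deriv e f p"
  have unit: "e * (\<iota> p * a) = - (\<iota> p * (e * a)) - (2 * inner e (\<iota> p)) *\<^sub>R a"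
    if "Ret e = 0" for e a
  proof -
    have "e * \<iota> p = - (\<iota> p * e) - (2 * inner e (\<iota> p)) *\<^sub>R 1"
      by (rule imaginary_mult_commute[OF that]) (simp add: \<iota>_def)
    then have "(e * \<iota> p) * a = (- (\<iota> p * e) - (2 * inner e (\<iota> p)) *\<^sub>R 1) * a"
      by simp
    then show ?thesis
      by (simp add: algebra_simps)
  qed
  have radial: "radial_deriv f p =
      inner qi (\<iota> p) *\<^sub>R ?d qi + inner qj (\<iota> p) *\<^sub>R ?d qj + inner qk (\<iota> p) *\<^sub>R ?d qk"
    unfolding radial_deriv_eq[OF assms] by (simp add: \<iota>_def inner_quat_def algebra_simps)
  have "left_Fueter (\<lambda>q. \<iota> q * f q) p = left_Fueter \<iota> p * f p
      + (\<iota> p * ?d 1 + qi * (\<iota> p * ?d qi) + qj * (\<iota> p * ?d qj) + qk * (\<iota> p * ?d qk))"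
    unfolding left_Fueter_def partial_deriv_mult[OF iota_differentiable[OF assms(1)] f]
    by (simp add: algebra_simps)
  also have "left_Fueter \<iota> p * f p = (- 2 *\<^sub>R f p) /\<^sub>R rad p"
    by (simp add: left_Fueter_iota[OF assms(1)] divide_inverse mult.commute)
  also have "\<iota> p * ?d 1 + qi * (\<iota> p * ?d qi) + qj * (\<iota> p * ?d qj) + qk * (\<iota> p * ?d qk)
      = 2 *\<^sub>R (\<iota> p * ?d 1) - \<iota> p * left_Fueter f p - 2 *\<^sub>R radial_deriv f p"
    unfolding radial
    by (simp add: unit[of qi] unit[of qj] unit[of qk] left_Fueter_def algebra_simps scaleR_2)
  also have "radial_deriv f p = - (\<iota> p * (\<iota> p * radial_deriv f p))"
    by (simp add: iota_mult_iota_mult[OF assms(1)])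
  finally show ?thesis
    by (simp add: left_Cullen_def algebra_simps)
qed

section \<open>The equivalences\<close>

lemma Cullen_iff_left_Fueter_iota_mult:
  assumes "p \<notin> \<real>" and "f differentiable (at p)"
  shows "left_Cullen f p = 0 \<longleftrightarrow>
    left_Fueter (\<lambda>q. \<iota> q * f q) p + \<iota> p * left_Fueter f p = (- 2 *\<^sub>R f p) /\<^sub>R rad p"
proof -
  have "left_Cullen f p = 0 \<longleftrightarrow> \<iota> p * left_Cullen f p = 0"
    using iota_mult_iota_mult[OF assms(1), of "left_Cullen f p"] by auto
  then show ?thesis
    by (simp add: left_Fueter_iota_mult[OF assms])
qed

text \<open>The two equations for \<open>D\<^sub>l f\<close> and \<open>D\<^sub>l(\<iota> f)\<close> can be solved for \<open>v\<close> and \<open>u\<close>, so a pair exists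
  if and only if this one candidate decomposes \<open>f\<close>.\<close>

lemma ex_Fueter_pair_iff:
  "(\<exists>u v. Fueter_pair f \<Omega> u v) \<longleftrightarrow>
    (\<forall>p\<in>\<Omega> - \<real>. left_Fueter (\<lambda>q. \<iota> q * f q) p + \<iota> p * left_Fueter f p = (- 2 *\<^sub>R f p) /\<^sub>R rad p)"
    (is "_ \<longleftrightarrow> (\<forall>p\<in>_. ?eq p)")
proof
  assume "\<exists>u v. Fueter_pair f \<Omega> u v"
  then show "\<forall>p\<in>\<Omega> - \<real>. ?eq p"
    by (auto simp: Fueter_pair_def algebra_simps)
next
  assume eq: "\<forall>p\<in>\<Omega> - \<real>. ?eq p"
  define u where "u p = - (rad p / 2) *\<^sub>R left_Fueter (\<lambda>q. \<iota> q * f q) p" for p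
  define v where "v p = - (rad p / 2) *\<^sub>R left_Fueter f p" for p
  have "Fueter_pair f \<Omega> u v"
    unfolding Fueter_pair_def
  proof
    fix p assume p: "p \<in> \<Omega> - \<real>"
    then have r: "rad p > 0"
      by (simp add: rad_pos)
    have "u p + \<iota> p * v p =
        - (rad p / 2) *\<^sub>R (left_Fueter (\<lambda>q. \<iota> q * f q) p + \<iota> p * left_Fueter f p)"
      by (simp add: u_def v_def algebra_simps)
    also have "\<dots> = f p"
      using eq p r by simp
    finally show "f p = u p + \<iota> p * v p \<and>
        left_Fueter f p = (- 2 *\<^sub>R v p) /\<^sub>R rad p \<and>
        left_Fueter (\<lambda>q. \<iota> q * f q) p = (- 2 *\<^sub>R u p) /\<^sub>R rad p"
      using r by (simp add: u_def v_def)
  qed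
  then show "\<exists>u v. Fueter_pair f \<Omega> u v"
    by blast
qed

lemma Fueter_pair_iff_weighted:
  assumes diff: "\<And>p. p \<in> \<Omega> - \<real> \<Longrightarrow> f differentiable (at p)"
  shows "Fueter_pair f \<Omega> u v \<longleftrightarrow> weighted_Fueter_pair f \<Omega> u v"
  unfolding Fueter_pair_def weighted_Fueter_pair_def
proof (intro ball_cong refl conj_cong)
  fix p assume p: "p \<in> \<Omega> - \<real>" and f: "f p = u p + \<iota> p * v p"
  then have notreal: "p \<notin> \<real>" and r: "rad p > 0"
    by (simp_all add: rad_pos)
  \<comment> \<open>The weight divides an equation \<open>D\<^sub>l g = c / r\<close> by \<open>r\<^sup>2\<close> and subtracts the correction term
     \<open>b = 2 \<iota> g / r\<^sup>3\<close> from both sides.\<close>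
  have shift: "A = c /\<^sub>R rad p \<longleftrightarrow> A /\<^sub>R (rad p)\<^sup>2 - b = d"
    if "c /\<^sub>R rad p ^ 3 = d + b" for A b c d :: quat
  proof -
    have "A = c /\<^sub>R rad p \<longleftrightarrow> A /\<^sub>R (rad p)\<^sup>2 = (c /\<^sub>R rad p) /\<^sub>R (rad p)\<^sup>2"
      using r by (simp del: scaleR_scaleR)
    also have "(c /\<^sub>R rad p) /\<^sub>R (rad p)\<^sup>2 = d + b"
      using that by (simp add: power2_eq_square power3_eq_cube mult.assoc)
    finally show ?thesis
      by (simp add: diff_eq_eq)
  qed
  show "left_Fueter f p = (- 2 *\<^sub>R v p) /\<^sub>R rad p \<longleftrightarrow>
      left_Fueter (\<lambda>q. f q /\<^sub>R (rad q)\<^sup>2) p = (- 2 *\<^sub>R (\<iota> p * u p)) /\<^sub>R rad p ^ 3"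
    unfolding left_Fueter_div_rad_power[OF notreal diff[OF p]]
    by (rule shift) (simp add: f iota_mult_iota_mult[OF notreal] power3_eq_cube algebra_simps)
  have iota_f: "(\<lambda>q. \<iota> q * f q) differentiable (at p)"
    using iota_differentiable[OF notreal] diff[OF p] by (rule differentiable_mult)
  show "left_Fueter (\<lambda>q. \<iota> q * f q) p = (- 2 *\<^sub>R u p) /\<^sub>R rad p \<longleftrightarrow>
      left_Fueter (\<lambda>q. (\<iota> q * f q) /\<^sub>R (rad q)\<^sup>2) p = (2 *\<^sub>R (\<iota> p * v p)) /\<^sub>R rad p ^ 3"
    unfolding left_Fueter_div_rad_power[OF notreal iota_f]
    by (rule shift) (simp add: f iota_mult_iota_mult[OF notreal] power3_eq_cube algebra_simps)
qed

theorem theorem1: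
  fixes \<Omega> :: "quat set" and f :: "quat \<Rightarrow> quat"
  assumes "open \<Omega>" and "connected \<Omega>" and "C1_on f \<Omega>"
  shows "(left_Cullen_regular f \<Omega> \<longleftrightarrow>
      (\<forall>p\<in>\<Omega> - \<real>.
        left_Fueter (\<lambda>q. \<iota> q * f q) p + \<iota> p * left_Fueter f p = (- 2 *\<^sub>R f p) /\<^sub>R rad p))
    \<and> (left_Cullen_regular f \<Omega> \<longleftrightarrow> (\<exists>u v. Fueter_pair f \<Omega> u v))
    \<and> (left_Cullen_regular f \<Omega> \<longleftrightarrow> (\<exists>u v. weighted_Fueter_pair f \<Omega> u v))
    \<and> (\<forall>u v. Fueter_pair f \<Omega> u v \<longleftrightarrow> weighted_Fueter_pair f \<Omega> u v)"
proof -
  have diff: "f differentiable (at p)" if "p \<in> \<Omega> - \<real>" for p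
    using assms(3) that by (auto simp: C1_on_def differentiable_def)
  have "left_Cullen_regular f \<Omega> \<longleftrightarrow>
      (\<forall>p\<in>\<Omega> - \<real>.
        left_Fueter (\<lambda>q. \<iota> q * f q) p + \<iota> p * left_Fueter f p = (- 2 *\<^sub>R f p) /\<^sub>R rad p)"
    using assms(3) diff by (simp add: left_Cullen_regular_def Cullen_iff_left_Fueter_iota_mult)
  moreover have "Fueter_pair f \<Omega> u v \<longleftrightarrow> weighted_Fueter_pair f \<Omega> u v" for u v
    by (rule Fueter_pair_iff_weighted[OF diff])
  ultimately show ?thesis
    unfolding ex_Fueter_pair_iff[symmetric] by blast
qed

end
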